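(* Let $f:\mathbb{R}^d\to\mathbb{R}$ be differentiable and convex with unique minimizer $x_\star$ and twice continuously differentiable at every $x\in\mathbb{R}^d\setminus\{x_\star\}$, let $k:\mathbb{R}^d\to\mathbb{R}$ be differentiable and strictly convex with minimum $k(0)=0$, and let $\gamma\in(0,1)$. Assume: (i) there exist a differentiable, non-increasing, convex function $\alpha:[0,\infty)\to(0,1]$ and a constant $C_{\alpha,\gamma}\in(0,\gamma]$ such that $k(p)\ge\alpha(k(p))\max(f_c^*(p),f_c^*(-p))$ for all $p\in\mathbb{R}^d$ and $-C_{\alpha,\gamma}\alpha'(y)y<\alpha(y)$ for all $y\in[0,\infty)$; (ii) there exists $C_{f,k}\in(0,\infty)$ such that $|\langle\nabla f(x),\nabla k(p)\rangle|\le C_{f,k}\mathcal{H}(x,p)$ for all $x,p\in\mathbb{R}^d$; (iii) there exists $C_k\in(0,\infty)$ such that $\langle\nabla k(p),p\rangle\le C_k k(p)$ for all $p\in\mathbb{R}^d$; (iv) there exists $D_{f,k}\in(0,\infty)$ such that $\langle\nabla k(p),\nabla^2f(x)\nabla k(p)\rangle\le D_{f,k}\,\alpha(3\mathcal{H}(x,p))\,\mathcal{H}(x,p)$ for all $p\in\mathbb{R}^d$ and $x\in\mathbb{R}^d\setminus\{x_\star\}$. Suppose $$0<\epsilon<\min\Big(\frac{1-\gamma}{2\max(C_{f,k}+6D_{f,k}/C_{\alpha,\gamma},1)},\ \frac{C_{\alpha,\gamma}}{10C_{f,k}+5\gamma C_k}\Big).$$ Let $\delta=(1+\gamma\epsilon)^{-1}$,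 $x_0\in\mathbb{R}^d$, $p_0=0$, and for $i\ge0$ $$p_{i+1}=\delta p_i-\epsilon\delta\nabla f(x_i),\qquad x_{i+1}=x_i+\epsilon\nabla k(p_{i+1}).$$ Let $\mathcal{H}_0=\mathcal{H}(x_0,p_0)$, $\alpha_\star=\alpha(3\mathcal{H}_0)$, $\mathcal{W}_0=f(x_0)-f(x_\star)$, and for $i\ge0$ $$\mathcal{W}_{i+1}=\mathcal{W}_i\Big(1+\frac{\epsilon C_{\alpha,\gamma}}{4}\big[1-\gamma-2\epsilon(C_{f,k}+6D_{f,k}/C_{\alpha,\gamma})\big]\alpha(2\mathcal{W}_i)\Big)^{-1}.$$ Then for every $i\ge0$, $$f(x_i)-f(x_\star)\le 2\mathcal{W}_i\le 2\mathcal{W}_0\Big(1+\frac{\epsilon C_{\alpha,\gamma}}{4}\big[1-\gamma-2\epsilon(C_{f,k}+6D_{f,k}/C_{\alpha,\gamma})\big]\alpha_\star\Big)^{-i}.$$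
   Context: $\langle\cdot,\cdot\rangle$ is the standard inner product on $\mathbb{R}^d$. $f_c(x)=f(x+x_\star)-f(x_\star)$, and $f_c^*(p)=\sup\{\langle x,p\rangle-f_c(x):x\in\mathbb{R}^d\}$ (possibly $+\infty$). $\mathcal{H}(x,p)=k(p)+f(x)-f(x_\star)$. $\nabla^2f$ is the Hessian of $f$. The recursion is the paper's first explicit method. *)

theory Defs
  imports "HOL-Analysis.Analysis"
begin

definition grad :: "('a::real_inner \<Rightarrow> real) \<Rightarrow> 'a \<Rightarrow> 'a" where
  "grad f x = (THE D. GDERIV f x :> D)"

lemma GDERIV_grad:
  fixes f :: "'a::euclidean_space \<Rightarrow> real"
  assumes "f differentiable (at x)"
  shows "GDERIV f x :> grad f x"
proof -
  obtain A where A: "(f has_derivative A) (at x)"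
    using assms by (auto simp: differentiable_def)
  then interpret A: bounded_linear A
    by (rule has_derivative_bounded_linear)
  have "A h = inner h (adjoint A 1)" for h
    using adjoint_works[OF A.linear_axioms, of h 1] by (simp only: inner_real_def mult_1_right)
  then have "A = (\<lambda>h. inner h (adjoint A 1))" ..
  then have G: "GDERIV f x :> adjoint A 1"
    using A by (simp add: gderiv_def)
  have uniq: "D = adjoint A 1" if "GDERIV f x :> D" for D
  proof -
    have "(\<lambda>h. inner h D) = (\<lambda>h. inner h (adjoint A 1))"
      using that G unfolding gderiv_def by (rule has_derivative_unique)
    then show ?thesis
      using vector_eq_ldot[of D "adjoint A 1"] by (simp only: fun_eq_iff)
  qed
  show ?thesis
    unfolding grad_def using G uniq by (rule theI)
qed

definition hessian :: "(real ^ 'n \<Rightarrow> real) \<Rightarrow> real ^ 'n \<Rightarrow> real ^ 'n ^ 'n" where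
  "hessian f x = jacobian (grad f) (at x)"

definition twice_continuously_differentiable_on :: "(real ^ 'n \<Rightarrow> real) \<Rightarrow> (real ^ 'n) set \<Rightarrow> bool" where
  "twice_continuously_differentiable_on f S \<longleftrightarrow>
     open S \<and>
     (\<forall>x\<in>S. f differentiable (at x)) \<and>
     (\<forall>x\<in>S. grad f differentiable (at x)) \<and>
     continuous_on S (hessian f)"

definition strictly_convex_on :: "'a::real_vector set \<Rightarrow> ('a \<Rightarrow> real) \<Rightarrow> bool" where
  "strictly_convex_on S f \<longleftrightarrow>
     convex S \<and>
     (\<forall>x\<in>S. \<forall>y\<in>S. \<forall>t. x \<noteq> y \<longrightarrow> 0 < t \<longrightarrow> t < 1 \<longrightarrow>
        f ((1 - t) *\<^sub>R x + t *\<^sub>R y) < (1 - t) * f x + t * f y)"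

definition convex_conjugate :: "('a::real_inner \<Rightarrow> real) \<Rightarrow> 'a \<Rightarrow> ereal" where
  "convex_conjugate g p = (SUP x. ereal (x \<bullet> p - g x))"

definition centered :: "('a::real_vector \<Rightarrow> real) \<Rightarrow> 'a \<Rightarrow> 'a \<Rightarrow> real" where
  "centered f xstar x = f (x + xstar) - f xstar"

definition hamiltonian :: "('a \<Rightarrow> real) \<Rightarrow> ('a \<Rightarrow> real) \<Rightarrow> 'a \<Rightarrow> 'a \<Rightarrow> 'a \<Rightarrow> real" where
  "hamiltonian f k xstar x p = k p + f x - f xstar"

end

theory Submission
  imports Defs
begin

text \<open>Write \<open>s = \<langle>x - x\<^sub>\<star>, p\<rangle>\<close> and \<open>\<beta>(y) = (C\<^sub>\<alpha> / 2) \<alpha>(2y)\<close>, and let the modified energy \<open>V\<close> be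
  the solution of \<open>V = H + \<beta>(V) s\<close> in \<open>[H / 2, 3 H / 2]\<close>. It exists because Young's inequality and
  (i) give \<open>\<alpha>(y) \<bar>s\<bar> \<le> H\<close> for \<open>y \<ge> H\<close>. If \<open>V'\<close> is the modified energy after one step, then
  convexity of \<open>f\<close> and \<open>k\<close> together with (ii) and (iv) shows that inserting \<open>V'\<close> into the equation
  for the old state leaves the residual
  \<open>V' - \<beta>(V') s - H \<le> - \<epsilon> (1 - \<gamma> - 2 \<epsilon> (C\<^sub>f\<^sub>k + 6 D\<^sub>f\<^sub>k / C\<^sub>\<alpha>)) \<beta>(V') V'\<close>.
  The slow decay of \<open>\<alpha>\<close> makes \<open>y - \<beta>(y) s\<close> nondecreasing with slope at most 2 on \<open>y \<ge> H / 2\<close>, so the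
  residual turns into the contraction \<open>V' (1 + c \<alpha>(2V')) \<le> V\<close>, and \<open>V\<close> is dominated by \<open>W\<close>.\<close>

section \<open>First- and second-order bounds along a segment\<close>

text \<open>Restricting \<open>f\<close> to the line through \<open>x\<close> and \<open>y\<close>
  reduces this to the one-dimensional tangent at parameter 0, read off at 1.\<close>

lemma convex_on_above_gradient:
  fixes f :: "'a::real_inner \<Rightarrow> real"
  assumes cvx: "convex_on UNIV f" and der: "GDERIV f x :> D"
  shows "f x + D \<bullet> (y - x) \<le> f y"
proof -
  define g where "g t = f (x + t *\<^sub>R (y - x))" for t :: real
  have "convex_on UNIV g"
  proof (rule convex_onI)
    fix t a b :: real assume t: "0 < t" "t < 1"
    have "x + ((1 - t) * a + t * b) *\<^sub>R (y - x)
        = (1 - t) *\<^sub>R (x + a *\<^sub>R (y - x)) + t *\<^sub>R (x + b *\<^sub>R (y - x))"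
      by (simp add: algebra_simps)
    then show "g ((1 - t) *\<^sub>R a + t *\<^sub>R b) \<le> (1 - t) * g a + t * g b"
      unfolding g_def using convex_onD[OF cvx, of t "x + a *\<^sub>R (y - x)" "x + b *\<^sub>R (y - x)"] t
      by simp
  qed simp
  moreover have "(g has_real_derivative D \<bullet> (y - x)) (at 0)"
  proof -
    have "((\<lambda>t. x + t *\<^sub>R (y - x)) has_derivative (\<lambda>t. t *\<^sub>R (y - x))) (at 0)"
      by (auto intro!: derivative_eq_intros)
    moreover have "(f has_derivative (\<lambda>h. h \<bullet> D)) (at (x + 0 *\<^sub>R (y - x)))"
      using der by (simp add: gderiv_def)
    ultimately have "(g has_derivative (\<lambda>t. (t *\<^sub>R (y - x)) \<bullet> D)) (at 0)"
      unfolding g_def by (rule has_derivative_compose)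
    then show ?thesis
      by (simp add: has_field_derivative_def inner_commute mult.commute[of _ "inner _ _"])
  qed
  ultimately have "g 1 - g 0 \<ge> (D \<bullet> (y - x)) * (1 - 0)"
    by (intro convex_on_imp_above_tangent[where A = UNIV]) auto
  then show ?thesis by (simp add: g_def)
qed

text \<open>No continuity of \<open>h'\<close> at \<open>a\<close> is assumed: \<open>h\<close> minus the parabola with slope
  \<open>h' b\<close> at \<open>b\<close> is nondecreasing, which bounds its derivative at \<open>a\<close>.\<close>

lemma deriv_diff_le_left:
  fixes h h' h'' :: "real \<Rightarrow> real"
  assumes ab: "a \<le> b"
    and h: "\<And>t. (h has_real_derivative h' t) (at t)"
    and h': "\<And>t. a < t \<Longrightarrow> t \<le> b \<Longrightarrow> (h' has_real_derivative h'' t) (at t)"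
    and le: "\<And>t. a < t \<Longrightarrow> t \<le> b \<Longrightarrow> h'' t \<le> B"
  shows "h' b - h' a \<le> B * (b - a)"
proof (rule ccontr)
  assume neg: "\<not> ?thesis"
  with ab have "a < b" by (cases "a = b") auto
  define r where "r t = h t - h' b * t + B * (b * t - t\<^sup>2 / 2)" for t
  have r: "(r has_real_derivative h' t - h' b + B * (b - t)) (at t)" for t
    unfolding r_def by (auto intro!: derivative_eq_intros h simp: algebra_simps)
  have nonneg: "0 \<le> h' t - h' b + B * (b - t)" if t: "a < t" "t \<le> b" for t
  proof -
    have "h' b - B * b \<le> h' t - B * t"
    proof (rule DERIV_nonpos_imp_nonincreasing[OF t(2)])
      fix u assume "t \<le> u" "u \<le> b"
      then show "\<exists>y. ((\<lambda>u. h' u - B * u) has_real_derivative y) (at u) \<and> y \<le> 0"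
        using t le[of u] by (intro exI[of _ "h'' u - B"]) (auto intro!: derivative_eq_intros h')
    qed
    then show ?thesis by (simp add: algebra_simps)
  qed
  have "h' a - h' b + B * (b - a) < 0" using neg by simp
  from DERIV_neg_dec_right[OF r this]
  obtain d where d: "d > 0" "\<And>e. 0 < e \<Longrightarrow> e < d \<Longrightarrow> r (a + e) < r a" by auto
  define e where "e = min (d / 2) (b - a)"
  have e: "0 < e" "e < d" "a + e \<le> b" using d(1) \<open>a < b\<close> by (auto simp: e_def)
  have "r a \<le> r (a + e)"
  proof (rule DERIV_nonneg_imp_increasing_open[of a "a + e"])
    show "continuous_on {a..a + e} r"
      using r by (meson DERIV_isCont continuous_at_imp_continuous_on)
    fix t assume "a < t" "t < a + e"
    then show "\<exists>y. (r has_real_derivative y) (at t) \<and> 0 \<le> y"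
      using r[of t] nonneg[of t] e(3) by auto
  qed (use e in auto)
  with d(2)[OF e(1,2)] show False by simp
qed

text \<open>Reflection at 0 reduces this to \<open>deriv_diff_le_left\<close>: \<open>h'\<close>
  changes sign, \<open>h''\<close> does not, and the exceptional endpoint becomes the right
  one.\<close>

lemma deriv_diff_le_right:
  fixes h h' h'' :: "real \<Rightarrow> real"
  assumes ab: "a \<le> b"
    and h: "\<And>t. (h has_real_derivative h' t) (at t)"
    and h': "\<And>t. a \<le> t \<Longrightarrow> t < b \<Longrightarrow> (h' has_real_derivative h'' t) (at t)"
    and le: "\<And>t. a \<le> t \<Longrightarrow> t < b \<Longrightarrow> h'' t \<le> B"
  shows "h' b - h' a \<le> B * (b - a)"
proof -
  have "- h' (- (- a)) - - h' (- (- b)) \<le> B * (- a - - b)"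
  proof (rule deriv_diff_le_left[where h = "\<lambda>t. h (- t)" and h'' = "\<lambda>t. h'' (- t)"])
    show "((\<lambda>t. h (- t)) has_real_derivative - h' (- t)) (at t)" for t
    proof -
      have "((\<lambda>t. h (- t)) has_real_derivative h' (- t) * - 1) (at t)"
        by (rule DERIV_chain2[OF h]) (auto intro!: derivative_eq_intros)
      then show ?thesis by simp
    qed
    show "((\<lambda>t. - h' (- t)) has_real_derivative h'' (- t)) (at t)"
      if t: "- b < t" "t \<le> - a" for t
    proof -
      have "((\<lambda>t. h' (- t)) has_real_derivative h'' (- t) * - 1) (at t)"
        by (rule DERIV_chain2[OF h']) (use t in \<open>auto intro!: derivative_eq_intros\<close>)
      from DERIV_minus[OF this] show ?thesis by simp
    qed
  qed (use ab le in auto)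
  then show ?thesis by simp
qed

text \<open>The point \<open>c\<close> stands for the parameter at which a segment meets the
  minimizer, where no second derivative is assumed. Splitting at \<open>c\<close> leaves an
  exceptional endpoint on each side, and the two bounds add up.\<close>

lemma deriv_diff_le_except_point:
  fixes h h' h'' :: "real \<Rightarrow> real"
  assumes h: "\<And>t. (h has_real_derivative h' t) (at t)"
    and h': "\<And>t. 0 \<le> t \<Longrightarrow> t \<le> 1 \<Longrightarrow> t \<noteq> c \<Longrightarrow> (h' has_real_derivative h'' t) (at t)"
    and le: "\<And>t. 0 \<le> t \<Longrightarrow> t \<le> 1 \<Longrightarrow> t \<noteq> c \<Longrightarrow> h'' t \<le> B"
  shows "h' 1 - h' 0 \<le> B"
proof (cases "0 \<le> c \<and> c \<le> 1")
  case True
  have "h' 1 - h' c \<le> B * (1 - c)"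
    by (rule deriv_diff_le_left[OF _ h h' le]) (use True in auto)
  moreover have "h' c - h' 0 \<le> B * (c - 0)"
    by (rule deriv_diff_le_right[OF _ h h' le]) (use True in auto)
  ultimately show ?thesis by (simp add: algebra_simps)
next
  case False
  have "h' 1 - h' 0 \<le> B * (1 - 0)"
    by (rule deriv_diff_le_left[OF _ h h' le]) (use False in auto)
  then show ?thesis by simp
qed

text \<open>A line with nonzero direction meets \<open>z\<close> at most once, so \<open>f\<close>
  along it is twice differentiable except at one parameter.\<close>

lemma inner_grad_diff_le:
  fixes f :: "real ^ 'n \<Rightarrow> real"
  assumes diff: "\<And>y. f differentiable (at y)"
    and C2: "twice_continuously_differentiable_on f (- {z})"
    and bound: "\<And>t. 0 \<le> t \<Longrightarrow> t \<le> 1 \<Longrightarrow> x + t *\<^sub>R v \<noteq> z \<Longrightarrow>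
      v \<bullet> (hessian f (x + t *\<^sub>R v) *v v) \<le> B"
    and B: "0 \<le> B"
  shows "(grad f (x + v) - grad f x) \<bullet> v \<le> B"
proof (cases "v = 0")
  case True
  then show ?thesis using B by simp
next
  case v: False
  \<comment> \<open>If the line misses \<open>z\<close>, then \<open>c\<close> is an arbitrary
    number, and excluding it does no harm.\<close>
  define c where "c = (SOME t. x + t *\<^sub>R v = z)"
  have ne: "x + t *\<^sub>R v \<noteq> z" if "t \<noteq> c" for t
  proof
    assume eq: "x + t *\<^sub>R v = z"
    then have "x + c *\<^sub>R v = z" unfolding c_def by (rule someI)
    with eq have "t *\<^sub>R v = c *\<^sub>R v" by (metis add_left_cancel)
    then show False using that v by simp
  qed
  have line: "((\<lambda>t. x + t *\<^sub>R v) has_derivative (\<lambda>s. s *\<^sub>R v)) (at t)" for t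
    by (auto intro!: derivative_eq_intros)
  define h' where "h' t = grad f (x + t *\<^sub>R v) \<bullet> v" for t
  have "h' 1 - h' 0 \<le> B"
  proof (rule deriv_diff_le_except_point[where h = "\<lambda>t. f (x + t *\<^sub>R v)" and c = c
        and h'' = "\<lambda>t. v \<bullet> (hessian f (x + t *\<^sub>R v) *v v)"])
    fix t
    have "((\<lambda>t. f (x + t *\<^sub>R v)) has_derivative (\<lambda>s. (s *\<^sub>R v) \<bullet> grad f (x + t *\<^sub>R v))) (at t)"
      using GDERIV_grad[OF diff] unfolding gderiv_def by (rule has_derivative_compose[OF line])
    then show "((\<lambda>t. f (x + t *\<^sub>R v)) has_real_derivative h' t) (at t)"
      by (simp add: h'_def has_field_derivative_def inner_commute mult.commute[of _ "inner _ _"])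
  next
    fix t :: real assume t: "0 \<le> t" "t \<le> 1" "t \<noteq> c"
    let ?J = "hessian f (x + t *\<^sub>R v)"
    have "grad f differentiable (at (x + t *\<^sub>R v))"
      using C2 ne[OF t(3)] unfolding twice_continuously_differentiable_on_def by auto
    then have "(grad f has_derivative (\<lambda>h. ?J *v h)) (at (x + t *\<^sub>R v))"
      unfolding hessian_def using jacobian_works by blast
    from has_derivative_compose[OF line this]
    have "(h' has_derivative (\<lambda>s. (?J *v (s *\<^sub>R v)) \<bullet> v)) (at t)"
      unfolding h'_def by (rule has_derivative_inner_left)
    then show "(h' has_real_derivative v \<bullet> (?J *v v)) (at t)"
      by (simp add: has_field_derivative_def matrix_vector_mult_scaleR inner_commute
          mult.commute[of _ "inner _ _"])
    show "v \<bullet> (?J *v v) \<le> B" using bound[OF t(1,2) ne[OF t(3)]] .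
  qed
  then show ?thesis by (simp add: h'_def inner_diff_left)
qed

section \<open>Conjugate bound and scalar inequalities\<close>

text \<open>Fenchel-Young, scaled by \<open>a\<close>. The conjugate may be infinite, so the product
  stays in the extended reals until one affine term is extracted.\<close>

lemma inner_le_add_convex_conjugate:
  fixes g :: "'a::real_inner \<Rightarrow> real"
  assumes "ereal a * convex_conjugate g q \<le> ereal b" "0 \<le> a"
  shows "a * (y \<bullet> q - g y) \<le> b"
proof -
  have "ereal (y \<bullet> q - g y) \<le> convex_conjugate g q"
    unfolding convex_conjugate_def by (rule SUP_upper) simp
  then have "ereal a * ereal (y \<bullet> q - g y) \<le> ereal a * convex_conjugate g q"
    using assms(2) by (intro ereal_mult_left_mono) auto
  also note assms(1)
  finally show ?thesis by simp
qed

text \<open>Integrated form of the slow decay: the tangent at \<open>y\<close> lies below \<alpha>,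
  so the drop from \<open>y\<close> to \<open>z\<close> is at most -\<alpha>'(y) (z - y), and
  \<open>slow\<close> bounds -C \<alpha>'(y) y. The tangent argument needs an interior point, hence
  the separate case \<open>y = 0\<close>.\<close>

lemma convex_slow_decay:
  fixes \<alpha> \<alpha>' :: "real \<Rightarrow> real"
  assumes cvx: "convex_on {0..} \<alpha>"
    and der: "\<And>y. y \<ge> 0 \<Longrightarrow> (\<alpha> has_real_derivative \<alpha>' y) (at y within {0..})"
    and slow: "\<And>y. y \<ge> 0 \<Longrightarrow> - C * \<alpha>' y * y < \<alpha> y"
    and C: "0 \<le> C" and yz: "0 \<le> y" "y \<le> z"
  shows "C * y * (\<alpha> y - \<alpha> z) \<le> \<alpha> y * (z - y)"
proof (cases "y = 0")
  case True
  then show ?thesis using slow[of 0] yz by simp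
next
  case False
  with yz have y: "y > 0" by simp
  have "\<alpha> z - \<alpha> y \<ge> \<alpha>' y * (z - y)"
    by (rule convex_on_imp_above_tangent[OF cvx])
      (use y yz der in \<open>auto simp: interior_Ici\<close>)
  then have "C * y * (\<alpha> y - \<alpha> z) \<le> C * y * (- \<alpha>' y * (z - y))"
    using C y by (intro mult_left_mono) auto
  also have "\<dots> = (- C * \<alpha>' y * y) * (z - y)" by simp
  also have "\<dots> \<le> \<alpha> y * (z - y)"
    using slow[of y] y yz by (intro mult_right_mono) auto
  finally show ?thesis .
qed

text \<open>The step size enters through \<open>2 * \<epsilon> \<le> 1 - \<gamma>\<close>. With it, the worst case
  \<open>b = C / 2\<close> leaves the factor \<open>(\<gamma> - C) * (1 - \<epsilon> * C / 2)\<close> in front of \<open>k\<close>.\<close>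

lemma dissipation_lower_bound:
  fixes b C \<gamma> \<epsilon> k \<phi> s :: real
  assumes b: "0 \<le> b" "b \<le> C / 2" and C: "C \<le> \<gamma>" and \<gamma>: "0 < \<gamma>" "\<gamma> < 1"
    and \<epsilon>: "0 \<le> \<epsilon>" "2 * \<epsilon> \<le> 1 - \<gamma>" and nonneg: "0 \<le> k" "0 \<le> \<phi>"
    and s: "b * \<bar>s\<bar> \<le> b * \<phi> + C / 2 * k"
  shows "(1 - \<gamma>) * b * (k + \<phi> + b * s) \<le> (\<gamma> - b * (1 + \<gamma> * \<epsilon>)) * k + \<gamma> * b * s + b * \<phi>"
proof -
  \<comment> \<open>\<open>A\<close> and \<open>B\<close> are the coefficients of \<open>k\<close>
    and \<open>b * s\<close> in the difference of the two sides.\<close>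
  define A where "A = \<gamma> - b * (2 - \<gamma> + \<gamma> * \<epsilon>)"
  define B where "B = \<gamma> - (1 - \<gamma>) * b"
  have C0: "0 \<le> C" using b by simp
  have ge: "\<gamma> * \<epsilon> \<le> \<epsilon>" using \<gamma> \<epsilon> by (simp add: mult_left_le_one_le)
  have g2: "\<gamma> * \<gamma> \<le> \<gamma>" using \<gamma> by (simp add: mult_left_le_one_le)
  have gge: "\<gamma> * (\<gamma> * \<epsilon>) \<le> \<gamma> * \<gamma>" using ge \<epsilon> \<gamma> by (intro mult_left_mono) (auto simp: mult_left_le)
  have B: "0 \<le> B"
  proof -
    have "(1 - \<gamma>) * b \<le> 1 * b" using b \<gamma> by (intro mult_right_mono) auto
    then show ?thesis using b C \<gamma> by (simp add: B_def)
  qed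
  have diff: "(\<gamma> - b * (1 + \<gamma> * \<epsilon>)) * k + \<gamma> * b * s + b * \<phi> - (1 - \<gamma>) * b * (k + \<phi> + b * s)
      = k * A + B * (b * s) + \<gamma> * (b * \<phi>)"
    unfolding A_def B_def by algebra
  have "0 \<le> k * A + B * (b * s) + \<gamma> * (b * \<phi>)"
  proof (cases "0 \<le> s")
    case True
    have "b * (2 - \<gamma> + \<gamma> * \<epsilon>) \<le> (\<gamma> / 2) * (2 - \<gamma> + \<gamma> * \<epsilon>)"
      using b C \<gamma> \<epsilon> by (intro mult_right_mono) auto
    also have "\<dots> \<le> \<gamma>" using gge by (simp add: algebra_simps)
    finally have "0 \<le> A" by (simp add: A_def)
    then show ?thesis using True b B \<gamma> nonneg by (intro add_nonneg_nonneg mult_nonneg_nonneg) auto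
  next
    case False
    have "- (b * s) \<le> b * \<phi> + C / 2 * k" using s False by simp
    from mult_left_mono[OF this B]
    have 1: "B * (b * s) \<ge> - B * (b * \<phi> + C / 2 * k)" by simp
    have 2: "0 \<le> 2 - \<gamma> + \<gamma> * \<epsilon> - (1 - \<gamma>) * C / 2"
    proof -
      have "(1 - \<gamma>) * C \<le> 1 * C" using C0 \<gamma> by (intro mult_right_mono) auto
      moreover have "0 \<le> \<gamma> * \<epsilon>" using \<gamma> \<epsilon> by simp
      ultimately show ?thesis using C \<gamma> by simp
    qed
    have 3: "(\<gamma> - C) * (1 - \<epsilon> * C / 2) \<ge> 0"
    proof -
      have "\<epsilon> * C \<le> 1 * 1" using C C0 \<gamma> \<epsilon> by (intro mult_mono) auto
      then show ?thesis using C by (intro mult_nonneg_nonneg) auto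
    qed
    have 4: "(1 - \<gamma>) * (C * C / 4) \<ge> 2 * \<epsilon> * (C * C / 4)"
      using \<epsilon> C0 by (intro mult_right_mono) auto
    \<comment> \<open>After \<open>b * s\<close> is replaced by its lower bound, \<open>k\<close>
      has the coefficient \<open>A - B * C / 2\<close>. By \<open>2\<close> it is nonincreasing in
      \<open>b\<close>, so it is least at \<open>b = C / 2\<close>, where \<open>3\<close> and
      \<open>4\<close> make it nonnegative.\<close>
    have "A - B * C / 2
        = \<gamma> * (1 - C / 2) - b * (2 - \<gamma> + \<gamma> * \<epsilon> - (1 - \<gamma>) * C / 2)"
      by (simp add: A_def B_def field_simps)
    moreover have "b * (2 - \<gamma> + \<gamma> * \<epsilon> - (1 - \<gamma>) * C / 2)
        \<le> C / 2 * (2 - \<gamma> + \<gamma> * \<epsilon> - (1 - \<gamma>) * C / 2)"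
      using b 2 by (intro mult_right_mono) auto
    moreover have "\<gamma> * (1 - C / 2) - C / 2 * (2 - \<gamma> + \<gamma> * \<epsilon> - (1 - \<gamma>) * C / 2)
        = (\<gamma> - C) * (1 - \<epsilon> * C / 2) + ((1 - \<gamma>) * (C * C / 4) - 2 * \<epsilon> * (C * C / 4))"
      by (simp add: field_simps)
    ultimately have "0 \<le> A - B * C / 2" using 3 4 by linarith
    then have "0 \<le> k * (A - B * C / 2) + (1 - \<gamma>) * b * (b * \<phi>)"
      using nonneg b \<gamma> by (intro add_nonneg_nonneg mult_nonneg_nonneg) auto
    also have "\<dots> = k * A - B * (b * \<phi> + C / 2 * k) + \<gamma> * (b * \<phi>)"
      by (simp add: B_def field_simps)
    finally show ?thesis using 1 by linarith
  qed
  with diff show ?thesis by linarith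
qed

section \<open>The modified energy equation\<close>

text \<open>Intermediate value theorem: for \<open>2 * y \<ge> H\<close> the perturbation is at most
  \<open>C / 2 * H\<close>, so \<open>F\<close> is at most \<open>H\<close> at the left end of the
  interval and at least \<open>H\<close> at the right end.\<close>

lemma modified_energy_exists:
  fixes \<alpha> :: "real \<Rightarrow> real"
  assumes cont: "continuous_on {0..} \<alpha>"
    and pos: "\<And>y. 0 \<le> y \<Longrightarrow> 0 < \<alpha> y"
    and young: "\<And>y. H \<le> y \<Longrightarrow> \<alpha> y * \<bar>s\<bar> \<le> H"
    and H: "0 \<le> H" and C: "0 \<le> C" "C \<le> 1"
  obtains V where "H / 2 \<le> V" "V \<le> 3 / 2 * H" "V = H + C / 2 * \<alpha> (2 * V) * s"
proof -
  define F where "F y = y - C / 2 * \<alpha> (2 * y) * s" for y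
  have small: "\<bar>C / 2 * \<alpha> (2 * y) * s\<bar> \<le> H / 2" if "H \<le> 2 * y" for y
  proof -
    have "\<bar>C / 2 * \<alpha> (2 * y) * s\<bar> = C / 2 * (\<alpha> (2 * y) * \<bar>s\<bar>)"
      using pos[of "2 * y"] H C that by (simp add: abs_mult)
    also have "\<dots> \<le> 1 / 2 * H"
      using young[OF that] pos[of "2 * y"] H C that by (intro mult_mono) auto
    finally show ?thesis by simp
  qed
  have "\<exists>V. H / 2 \<le> V \<and> V \<le> 3 / 2 * H \<and> F V = H"
  proof (rule IVT')
    show "F (H / 2) \<le> H" "H \<le> F (3 / 2 * H)"
      using small[of "H / 2"] small[of "3 / 2 * H"] H by (auto simp: F_def abs_le_iff)
    show "continuous_on {H / 2..3 / 2 * H} F"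
      unfolding F_def using H
      by (intro continuous_intros continuous_on_compose2[OF cont]) auto
  qed (use H in simp)
  then obtain V where "H / 2 \<le> V" "V \<le> 3 / 2 * H" "V = H + C / 2 * \<alpha> (2 * V) * s"
    unfolding F_def by (metis diff_eq_eq)
  then show ?thesis by (rule that)
qed

text \<open>Slow decay at \<open>2 * u\<close> has the factor \<open>2 * u\<close> on the left;
  Young's bound puts the same factor on the right, and it cancels. If \<open>u = 0\<close>, Young's
  bound forces \<open>s = 0\<close>.\<close>

lemma modified_energy_lipschitz:
  fixes \<alpha> :: "real \<Rightarrow> real"
  assumes slow: "\<And>y z. 0 \<le> y \<Longrightarrow> y \<le> z \<Longrightarrow> C * y * (\<alpha> y - \<alpha> z) \<le> \<alpha> y * (z - y)"
    and pos: "\<And>y. 0 \<le> y \<Longrightarrow> 0 < \<alpha> y"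
    and young: "\<And>y. H \<le> y \<Longrightarrow> \<alpha> y * \<bar>s\<bar> \<le> H"
    and u: "0 \<le> u" "H \<le> 2 * u" "u \<le> v"
  shows "(C / 2 * \<alpha> (2 * u) - C / 2 * \<alpha> (2 * v)) * \<bar>s\<bar> \<le> v - u"
proof (cases "u = 0")
  case True
  then have "\<alpha> 0 * \<bar>s\<bar> \<le> 0" using young[of 0] u by simp
  then have "s = 0" using pos[of 0] by (simp add: mult_le_0_iff)
  then show ?thesis using u by simp
next
  case False
  have "2 * u * (C * (\<alpha> (2 * u) - \<alpha> (2 * v)) * \<bar>s\<bar>)
      = (C * (2 * u) * (\<alpha> (2 * u) - \<alpha> (2 * v))) * \<bar>s\<bar>"
    by simp
  also have "\<dots> \<le> (\<alpha> (2 * u) * (2 * v - 2 * u)) * \<bar>s\<bar>"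
    using slow[of "2 * u" "2 * v"] u by (intro mult_right_mono) auto
  also have "\<dots> = (\<alpha> (2 * u) * \<bar>s\<bar>) * (2 * v - 2 * u)" by simp
  also have "\<dots> \<le> (2 * u) * (2 * v - 2 * u)"
    using young[of "2 * u"] u by (intro mult_right_mono) auto
  finally have "C * (\<alpha> (2 * u) - \<alpha> (2 * v)) * \<bar>s\<bar> \<le> 2 * v - 2 * u"
    using False u by (simp only: mult_le_cancel_left_pos)
  then show ?thesis by (simp add: algebra_simps)
qed

text \<open>The map y - \<beta>(y) s equals \<open>H\<close> at \<open>V\<close> and is at most
  \<open>H - 2 * r * V'\<close> at \<open>V'\<close>. For \<open>s < 0\<close> its slope is at most
  1; for \<open>s \<ge> 0\<close> it is only at most 2, which is why half of the rate
  \<open>2 * r\<close> survives.\<close>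

lemma modified_energy_contracts:
  fixes \<alpha> :: "real \<Rightarrow> real"
  assumes slow: "\<And>y z. 0 \<le> y \<Longrightarrow> y \<le> z \<Longrightarrow> C * y * (\<alpha> y - \<alpha> z) \<le> \<alpha> y * (z - y)"
    and pos: "\<And>y. 0 \<le> y \<Longrightarrow> 0 < \<alpha> y"
    and anti: "\<And>y z. 0 \<le> y \<Longrightarrow> y \<le> z \<Longrightarrow> \<alpha> z \<le> \<alpha> y"
    and young: "\<And>y. H \<le> y \<Longrightarrow> \<alpha> y * \<bar>s\<bar> \<le> H"
    and C: "0 \<le> C"
    and V: "0 \<le> V" "H \<le> 2 * V" "V = H + C / 2 * \<alpha> (2 * V) * s"
    and V': "0 \<le> V'" "V' - C / 2 * \<alpha> (2 * V') * s - H \<le> - (2 * r * V')"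
    and r: "0 < r" "r \<le> 1"
  shows "V' * (1 + r) \<le> V"
proof -
  define \<beta> where "\<beta> y = C / 2 * \<alpha> (2 * y)" for y
  have \<beta>_anti: "\<beta> z \<le> \<beta> y" if "0 \<le> y" "y \<le> z" for y z
    using anti[of "2 * y" "2 * z"] that C by (auto simp: \<beta>_def mult_left_mono)
  have lip: "(\<beta> u - \<beta> v) * \<bar>s\<bar> \<le> v - u" if "0 \<le> u" "H \<le> 2 * u" "u \<le> v" for u v
    unfolding \<beta>_def by (rule modified_energy_lipschitz[OF slow pos young that])
  have eq: "V - \<beta> V * s = H" using V(3) by (simp add: \<beta>_def)
  have le: "V' - \<beta> V' * s - H \<le> - (2 * r * V')" using V'(2) by (simp add: \<beta>_def)
  have rV': "0 \<le> r * V'" using r V' by simp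
  have rhs: "V' * (1 + r) = V' + r * V'" by (simp add: algebra_simps)
  show ?thesis
  proof (cases "s < 0")
    case s: True
    show ?thesis
    proof (cases "V' \<le> V")
      case True
      have "(\<beta> V' - \<beta> V) * s \<le> 0"
        using \<beta>_anti[OF V'(1) True] s by (simp add: mult_nonneg_nonpos)
      then show ?thesis using eq le rV' rhs by (simp add: left_diff_distrib)
    next
      case False
      have "(\<beta> V - \<beta> V') * \<bar>s\<bar> \<le> V' - V" using lip[of V V'] V False by simp
      then have "r * V' \<le> 0" using eq le s by (simp add: algebra_simps)
      then show ?thesis using False V(1) r by (simp add: mult_le_0_iff)
    qed
  next
    case s: False
    have le_V: "V' \<le> V"
    proof (rule ccontr)
      assume "\<not> V' \<le> V"
      moreover from this have "0 \<le> (\<beta> V - \<beta> V') * s"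
        using \<beta>_anti[of V V'] V s by simp
      ultimately show False using eq le rV' by (simp add: left_diff_distrib)
    qed
    show ?thesis
    proof (cases "H \<le> 2 * V'")
      case True
      then have "(\<beta> V' - \<beta> V) * s \<le> V - V'" using lip[of V' V] V' le_V s by simp
      then show ?thesis using eq le rhs by (simp add: left_diff_distrib)
    next
      \<comment> \<open>Here \<open>V'\<close> lies below the range of the Lipschitz bound, but V
        \<ge> H > 2 V' already suffices since r \<le> 1.\<close>
      case False
      have "0 \<le> \<beta> V * s" using C pos[of "2 * V"] V s by (simp add: \<beta>_def)
      moreover have "r * V' \<le> V'" using r V' by (simp add: mult_left_le_one_le)
      ultimately show ?thesis using eq False rhs by linarith
    qed
  qed
qed

theorem proposition3p3:
  fixes f k :: "real ^ 'n \<Rightarrow> real"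
    and xstar :: "real ^ 'n"
    and \<alpha> \<alpha>' :: "real \<Rightarrow> real"
    and \<gamma> \<epsilon> \<delta> C\<^sub>\<alpha> C\<^sub>f\<^sub>k C\<^sub>k D\<^sub>f\<^sub>k H0 \<alpha>star :: real
    and x p :: "nat \<Rightarrow> real ^ 'n"
    and W :: "nat \<Rightarrow> real"
  assumes f_diff: "f differentiable_on UNIV"
    and f_convex: "convex_on UNIV f"
    and f_min: "{y. \<forall>z. f y \<le> f z} = {xstar}"
    and f_C2: "twice_continuously_differentiable_on f (- {xstar})"
    and k_diff: "k differentiable_on UNIV"
    and k_convex: "strictly_convex_on UNIV k"
    and k_min: "k 0 = 0" "\<forall>q. k 0 \<le> k q"
    and gamma: "0 < \<gamma>" "\<gamma> < 1"
    \<comment> \<open>(i)\<close>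
    and alpha_range: "\<forall>y\<ge>0. 0 < \<alpha> y \<and> \<alpha> y \<le> 1"
    and alpha_diff: "\<forall>y\<ge>0. (\<alpha> has_real_derivative \<alpha>' y) (at y within {0..})"
    and alpha_antimono: "antimono_on {0..} \<alpha>"
    and alpha_convex: "convex_on {0..} \<alpha>"
    and C_alpha: "0 < C\<^sub>\<alpha>" "C\<^sub>\<alpha> \<le> \<gamma>"
    and k_conj: "\<forall>q. ereal (k q) \<ge> ereal (\<alpha> (k q)) *
           max (convex_conjugate (centered f xstar) q) (convex_conjugate (centered f xstar) (- q))"
    and alpha_deriv: "\<forall>y\<ge>0. - C\<^sub>\<alpha> * \<alpha>' y * y < \<alpha> y"
    \<comment> \<open>(ii)\<close>
    and C_fk: "0 < C\<^sub>f\<^sub>k"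
      "\<forall>y q. \<bar>grad f y \<bullet> grad k q\<bar> \<le> C\<^sub>f\<^sub>k * hamiltonian f k xstar y q"
    \<comment> \<open>(iii)\<close>
    and C_k: "0 < C\<^sub>k" "\<forall>q. grad k q \<bullet> q \<le> C\<^sub>k * k q"
    \<comment> \<open>(iv)\<close>
    and D_fk: "0 < D\<^sub>f\<^sub>k"
      "\<forall>q y. y \<noteq> xstar \<longrightarrow> grad k q \<bullet> (hessian f y *v grad k q)
          \<le> D\<^sub>f\<^sub>k * \<alpha> (3 * hamiltonian f k xstar y q) * hamiltonian f k xstar y q"
    and eps: "0 < \<epsilon>"
      "\<epsilon> < min ((1 - \<gamma>) / (2 * max (C\<^sub>f\<^sub>k + 6 * D\<^sub>f\<^sub>k / C\<^sub>\<alpha>) 1))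
               (C\<^sub>\<alpha> / (10 * C\<^sub>f\<^sub>k + 5 * \<gamma> * C\<^sub>k))"
    and delta: "\<delta> = inverse (1 + \<gamma> * \<epsilon>)"
    and p_0: "p 0 = 0"
    and p_Suc: "\<forall>i. p (Suc i) = \<delta> *\<^sub>R p i - (\<epsilon> * \<delta>) *\<^sub>R grad f (x i)"
    and x_Suc: "\<forall>i. x (Suc i) = x i + \<epsilon> *\<^sub>R grad k (p (Suc i))"
    and H0: "H0 = hamiltonian f k xstar (x 0) (p 0)"
    and alphastar: "\<alpha>star = \<alpha> (3 * H0)"
    and W_0: "W 0 = f (x 0) - f xstar"
    and W_Suc: "\<forall>i. W (Suc i) = W i * inverse (1 + \<epsilon> * C\<^sub>\<alpha> / 4 *
           (1 - \<gamma> - 2 * \<epsilon> * (C\<^sub>f\<^sub>k + 6 * D\<^sub>f\<^sub>k / C\<^sub>\<alpha>)) * \<alpha> (2 * W i))"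
  shows "\<forall>i. f (x i) - f xstar \<le> 2 * W i \<and>
           2 * W i \<le> 2 * W 0 * (1 + \<epsilon> * C\<^sub>\<alpha> / 4 *
             (1 - \<gamma> - 2 * \<epsilon> * (C\<^sub>f\<^sub>k + 6 * D\<^sub>f\<^sub>k / C\<^sub>\<alpha>)) * \<alpha>star) powi (- int i)"
proof -

  \<comment> \<open>Notation and convexity\<close>
  define \<phi> where "\<phi> y = f y - f xstar" for y
  define s where "s i = (x i - xstar) \<bullet> p i" for i
  define H where "H i = k (p i) + \<phi> (x i)" for i
  define K where "K = C\<^sub>f\<^sub>k + 6 * D\<^sub>f\<^sub>k / C\<^sub>\<alpha>"
  \<comment> \<open>The quarter arises from the factor 1/2 in \<beta> and the halving of the rate in
    \<open>modified_energy_contracts\<close>.\<close>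
  define c where "c = \<epsilon> * C\<^sub>\<alpha> / 4 * (1 - \<gamma> - 2 * \<epsilon> * K)"
  have Ham: "hamiltonian f k xstar y q = k q + \<phi> y" for y q
    by (simp add: hamiltonian_def \<phi>_def)
  have C0: "0 \<le> C\<^sub>\<alpha>" and C1: "C\<^sub>\<alpha> < 1" using C_alpha gamma by auto

  have min: "f xstar \<le> f y" for y
    using f_min by blast
  have \<phi>0: "0 \<le> \<phi> y" for y
    using min by (simp add: \<phi>_def)
  have k0: "0 \<le> k q" for q
    using k_min by simp
  have H_nonneg: "0 \<le> H i" for i
    using \<phi>0 k0 by (simp add: H_def)
  have f_diff_at: "f differentiable (at y)" for y
    using f_diff by (simp add: differentiable_on_def)
  have k_diff_at: "k differentiable (at q)" for q
    using k_diff by (simp add: differentiable_on_def)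
  have f_above: "f y + grad f y \<bullet> (z - y) \<le> f z" for y z
    by (rule convex_on_above_gradient[OF f_convex GDERIV_grad[OF f_diff_at]])
  have k_cvx: "convex_on UNIV k"
  proof (rule convex_onI)
    fix t :: real and u v :: "real ^ 'n"
    assume t: "0 < t" "t < 1"
    show "k ((1 - t) *\<^sub>R u + t *\<^sub>R v) \<le> (1 - t) * k u + t * k v"
    proof (cases "u = v")
      case True
      then show ?thesis by (simp add: scaleR_left_diff_distrib left_diff_distrib)
    next
      case False
      then show ?thesis
        using k_convex t unfolding strictly_convex_on_def by (simp add: less_imp_le)
    qed
  qed simp
  have k_above: "k q + grad k q \<bullet> (r - q) \<le> k r" for q r
    by (rule convex_on_above_gradient[OF k_cvx GDERIV_grad[OF k_diff_at]])

  \<comment> \<open>Hypothesis (i): properties of \<alpha> and Young's inequality\<close>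
  have \<alpha>_pos: "0 < \<alpha> y" and \<alpha>_le1: "\<alpha> y \<le> 1" if "0 \<le> y" for y
    using alpha_range that by auto
  have \<alpha>_anti: "\<alpha> z \<le> \<alpha> y" if "0 \<le> y" "y \<le> z" for y z
    using alpha_antimono that by (auto simp: monotone_on_def)
  have \<alpha>_slow: "C\<^sub>\<alpha> * y * (\<alpha> y - \<alpha> z) \<le> \<alpha> y * (z - y)" if "0 \<le> y" "y \<le> z" for y z
    by (rule convex_slow_decay[OF alpha_convex _ _ C0 that])
      (use alpha_diff alpha_deriv in auto)
  have \<alpha>_cont: "continuous_on {0..} \<alpha>"
    using alpha_diff by (intro DERIV_continuous_on) auto

  \<comment> \<open>Using both \<open>q\<close> and \<open>- q\<close>, covered by the maximum in
    (i), gives the absolute value.\<close>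
  have conj: "\<alpha> (k q) * (\<bar>(y - xstar) \<bullet> q\<bar> - \<phi> y) \<le> k q" for y q
  proof -
    let ?M = "max (convex_conjugate (centered f xstar) q) (convex_conjugate (centered f xstar) (- q))"
    have "\<alpha> (k q) * ((y - xstar) \<bullet> r - centered f xstar (y - xstar)) \<le> k q"
      if "convex_conjugate (centered f xstar) r \<le> ?M" for r
    proof (rule inner_le_add_convex_conjugate)
      have "ereal (\<alpha> (k q)) * convex_conjugate (centered f xstar) r \<le> ereal (\<alpha> (k q)) * ?M"
        using that \<alpha>_pos[OF k0] by (intro ereal_mult_left_mono) (auto simp: less_imp_le)
      also have "\<dots> \<le> ereal (k q)" using k_conj by blast
      finally show "ereal (\<alpha> (k q)) * convex_conjugate (centered f xstar) r \<le> ereal (k q)" .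
    qed (use \<alpha>_pos[OF k0] in \<open>simp add: less_imp_le\<close>)
    from this[of q] this[of "- q"] show ?thesis
      by (auto simp: centered_def \<phi>_def abs_if)
  qed
  \<comment> \<open>Lowering the weight from \<open>\<alpha> (k q)\<close> to
    \<open>\<alpha> y\<close> is monotone only when the bracket is nonnegative; otherwise the left
    side is nonpositive.\<close>
  have young: "\<alpha> y * \<bar>(z - xstar) \<bullet> q\<bar> \<le> \<alpha> y * \<phi> z + k q" if "k q \<le> y" for y z q
  proof -
    have y: "0 \<le> y" using that k0[of q] by simp
    have "\<alpha> y * (\<bar>(z - xstar) \<bullet> q\<bar> - \<phi> z) \<le> k q"
    proof (cases "\<bar>(z - xstar) \<bullet> q\<bar> \<le> \<phi> z")
      case True
      then show ?thesis using \<alpha>_pos[OF y] k0[of q]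
        by (smt (verit) mult_nonneg_nonpos)
    next
      case False
      then have "\<alpha> y * (\<bar>(z - xstar) \<bullet> q\<bar> - \<phi> z) \<le> \<alpha> (k q) * (\<bar>(z - xstar) \<bullet> q\<bar> - \<phi> z)"
        using \<alpha>_anti[OF k0 that] by (intro mult_right_mono) auto
      with conj[of q z] show ?thesis by simp
    qed
    then show ?thesis by (simp add: right_diff_distrib)
  qed
  have young_H: "\<alpha> y * \<bar>s i\<bar> \<le> H i" if "H i \<le> y" for y i
  proof -
    have ky: "k (p i) \<le> y" and y: "0 \<le> y"
      using that \<phi>0[of "x i"] k0[of "p i"] by (auto simp: H_def)
    have "\<alpha> y * \<phi> (x i) \<le> \<phi> (x i)"
      using \<alpha>_pos[OF y] \<alpha>_le1[OF y] \<phi>0 by (simp add: mult_left_le_one_le)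
    with young[OF ky, of "x i"] show ?thesis by (simp add: s_def H_def)
  qed

  \<comment> \<open>Step size restrictions and the Hessian along one step\<close>
  have eps1: "2 * \<epsilon> * max K 1 < 1 - \<gamma>"
  proof -
    have "\<epsilon> < (1 - \<gamma>) / (2 * max K 1)" using eps(2) by (simp add: K_def)
    then show ?thesis by (simp add: field_simps)
  qed
  \<comment> \<open>The two entries of the maximum give a positive rate and the condition of
    \<open>dissipation_lower_bound\<close>.\<close>
  then have "2 * \<epsilon> * K < 1 - \<gamma>" and eps2: "2 * \<epsilon> \<le> 1 - \<gamma>"
    using eps(1) mult_left_mono[of K "max K 1" "2 * \<epsilon>"] mult_left_mono[of 1 "max K 1" "2 * \<epsilon>"]
    by linarith+
  then have M: "0 < 1 - \<gamma> - 2 * \<epsilon> * K" by simp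
  have K: "0 < K" using C_fk D_fk C_alpha by (simp add: K_def add_pos_pos)
  have c0: "0 < c" using M eps C_alpha by (simp add: c_def)
  have c1: "c \<le> 1"
  proof -
    have "\<epsilon> * C\<^sub>\<alpha> \<le> 1 * 1" using eps2 C1 C0 eps(1) gamma by (intro mult_mono) auto
    then have "\<epsilon> * C\<^sub>\<alpha> / 4 * (1 - \<gamma> - 2 * \<epsilon> * K) \<le> 1 * 1"
      using M mult_pos_pos[OF eps(1) K] eps(1) C0 gamma by (intro mult_mono) auto
    then show ?thesis by (simp add: c_def)
  qed
  have eps_C: "10 * (\<epsilon> * C\<^sub>f\<^sub>k) \<le> C\<^sub>\<alpha>"
  proof -
    have "0 < 10 * C\<^sub>f\<^sub>k + 5 * \<gamma> * C\<^sub>k" using C_fk C_k gamma by (intro add_pos_pos) auto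
    then have "\<epsilon> * (10 * C\<^sub>f\<^sub>k + 5 * \<gamma> * C\<^sub>k) < C\<^sub>\<alpha>"
      using eps(2) by (simp add: pos_less_divide_eq)
    moreover have "0 \<le> \<epsilon> * (5 * \<gamma> * C\<^sub>k)" using eps gamma C_k by simp
    ultimately show ?thesis by (simp add: algebra_simps)
  qed

  text \<open>Along the segment from \<open>x i\<close> to \<open>x (Suc i)\<close> the energy stays within a factor 10/9 of its
    end value, so the slow decay of \<open>\<alpha>\<close> makes the bound (iv) uniform on the segment.\<close>
  have segment: "grad k q \<bullet> (hessian f z *v grad k q) \<le> 3 * D\<^sub>f\<^sub>k * (\<alpha> (3 * E) * E)"
    if E: "E = k q + \<phi> y" and z: "z = y - r *\<^sub>R grad k q" "0 \<le> r" "r \<le> \<epsilon>" "z \<noteq> xstar"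
    for q y z r E
  proof -
    define G where "G = k q + \<phi> z"
    have nonneg: "0 \<le> G" "0 \<le> E" using \<phi>0 k0 by (auto simp: G_def E)
    have small: "r * C\<^sub>f\<^sub>k * T \<le> C\<^sub>\<alpha> / 10 * T" if "0 \<le> T" for T
    proof -
      have "r * C\<^sub>f\<^sub>k \<le> \<epsilon> * C\<^sub>f\<^sub>k" using z C_fk by (intro mult_right_mono) auto
      then show ?thesis using eps_C that by (intro mult_right_mono) auto
    qed
    have CE: "C\<^sub>\<alpha> / 10 * T \<le> T / 10" if "0 \<le> T" for T
      using C1 C0 that by (simp add: mult_left_le_one_le)
    \<comment> \<open>The tangents of \<open>f\<close> at \<open>y\<close> and at \<open>z\<close>,
      with (ii) for the inner products, compare \<open>E\<close> and \<open>G\<close> in both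
      directions.\<close>
    have "f y + grad f y \<bullet> (z - y) \<le> f z" by (rule f_above)
    moreover have "r * (grad f y \<bullet> grad k q) \<le> r * (C\<^sub>f\<^sub>k * E)"
      using C_fk(2)[rule_format, of y q] z by (intro mult_left_mono) (auto simp: Ham E)
    ultimately have lower: "E - C\<^sub>\<alpha> / 10 * E \<le> G"
      using small[OF nonneg(2)] z by (simp add: E G_def \<phi>_def)
    have "f z + grad f z \<bullet> (y - z) \<le> f y" by (rule f_above)
    moreover have "r * - (grad f z \<bullet> grad k q) \<le> r * (C\<^sub>f\<^sub>k * G)"
      using C_fk(2)[rule_format, of z q] z by (intro mult_left_mono) (auto simp: Ham G_def)
    ultimately have upper: "G - C\<^sub>\<alpha> / 10 * G \<le> E"
      using small[OF nonneg(1)] z by (simp add: E G_def \<phi>_def)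
    \<comment> \<open>If \<open>E \<le> G\<close>, then \<open>G\<close> is at most 10/9 of
      \<open>E\<close> and \<alpha> is smaller at \<open>3 * G\<close>. Otherwise
      \<open>E - G\<close> is at most \<open>C\<^sub>\<alpha> / 10 * E\<close>, and this
      \<open>C\<^sub>\<alpha>\<close> cancels the one in the slow decay.\<close>
    have "\<alpha> (3 * G) * G \<le> 3 * (\<alpha> (3 * E) * E)"
    proof (cases "E \<le> G")
      case True
      then have "\<alpha> (3 * G) * G \<le> \<alpha> (3 * E) * (3 * E)"
        using upper CE[OF nonneg(1)] nonneg \<alpha>_anti[of "3 * E" "3 * G"] \<alpha>_pos[of "3 * E"]
        by (intro mult_mono) auto
      then show ?thesis by simp
    next
      case False
      have "C\<^sub>\<alpha> * (3 * G) * (\<alpha> (3 * G) - \<alpha> (3 * E)) \<le> \<alpha> (3 * G) * (3 * E - 3 * G)"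
        using False nonneg by (intro \<alpha>_slow) auto
      also have "\<dots> \<le> \<alpha> (3 * G) * (3 * (C\<^sub>\<alpha> / 10 * E))"
        using lower \<alpha>_pos[of "3 * G"] nonneg by (intro mult_left_mono) auto
      finally have "(3 * C\<^sub>\<alpha>) * (G * (\<alpha> (3 * G) - \<alpha> (3 * E))) \<le> (3 * C\<^sub>\<alpha>) * (\<alpha> (3 * G) * E / 10)"
        by (simp add: algebra_simps)
      then have "G * (\<alpha> (3 * G) - \<alpha> (3 * E)) \<le> \<alpha> (3 * G) * E / 10"
        by (rule mult_left_le_imp_le) (use C_alpha in simp)
      moreover have "\<alpha> (3 * G) * E \<le> \<alpha> (3 * G) * (2 * G)"
        using lower CE[OF nonneg(2)] nonneg \<alpha>_pos[of "3 * G"] by (intro mult_left_mono) auto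
      moreover have "\<alpha> (3 * E) * G \<le> \<alpha> (3 * E) * E" "0 \<le> \<alpha> (3 * E) * E"
        using False nonneg \<alpha>_pos[of "3 * E"] by (auto intro!: mult_left_mono)
      ultimately show ?thesis by (simp add: algebra_simps)
    qed
    then have "D\<^sub>f\<^sub>k * (\<alpha> (3 * G) * G) \<le> D\<^sub>f\<^sub>k * (3 * (\<alpha> (3 * E) * E))"
      using D_fk by (intro mult_left_mono) auto
    with D_fk(2)[rule_format, OF z(4), of q] show ?thesis
      by (simp add: Ham G_def algebra_simps)
  qed

  have exists: "\<exists>V. H i / 2 \<le> V \<and> V \<le> 3 / 2 * H i \<and> V = H i + C\<^sub>\<alpha> / 2 * \<alpha> (2 * V) * s i" for i
  proof -
    obtain V where "H i / 2 \<le> V" "V \<le> 3 / 2 * H i" "V = H i + C\<^sub>\<alpha> / 2 * \<alpha> (2 * V) * s i"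
      by (rule modified_energy_exists[OF \<alpha>_cont \<alpha>_pos young_H H_nonneg C0 less_imp_le[OF C1]])
    then show ?thesis by blast
  qed

  \<comment> \<open>Dissipation in one step\<close>
  have step: "V' - C\<^sub>\<alpha> / 2 * \<alpha> (2 * V') * s i - H i \<le> - (2 * (c * \<alpha> (2 * V')) * V')"
    if V': "H (Suc i) / 2 \<le> V'" "V' \<le> 3 / 2 * H (Suc i)"
      "V' = H (Suc i) + C\<^sub>\<alpha> / 2 * \<alpha> (2 * V') * s (Suc i)" for i V'
  proof -
    \<comment> \<open>The weight is frozen at the new energy \<open>V'\<close> for both states, so
      no difference of \<beta> values enters.\<close>
    define b where "b = C\<^sub>\<alpha> / 2 * \<alpha> (2 * V')"
    define q where "q = p (Suc i)"
    define y where "y = x (Suc i)"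
    define v where "v = grad k q"
    define P where "P = v \<bullet> q"
    have yx: "y = x i + \<epsilon> *\<^sub>R v" using x_Suc by (simp add: y_def v_def q_def)
    \<comment> \<open>The recursion is solved for the old momentum, so that the estimates are
      centred at the new one.\<close>
    have qp: "p i = (1 + \<gamma> * \<epsilon>) *\<^sub>R q + \<epsilon> *\<^sub>R grad f (x i)"
    proof -
      have "0 < 1 + \<gamma> * \<epsilon>" using gamma eps by (simp add: add_pos_pos)
      then have "(1 + \<gamma> * \<epsilon>) * \<delta> = 1" "(1 + \<gamma> * \<epsilon>) * (\<epsilon> * \<delta>) = \<epsilon>"
        by (simp_all add: delta)
      then show ?thesis using p_Suc by (simp add: q_def scaleR_right_diff_distrib)
    qed
    have V0: "0 \<le> V'" using V'(1) H_nonneg[of "Suc i"] by simp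
    have \<alpha>V: "0 < \<alpha> (2 * V')" "\<alpha> (2 * V') \<le> 1" using \<alpha>_pos \<alpha>_le1 V0 by auto
    have b: "0 \<le> b" "b \<le> C\<^sub>\<alpha> / 2" using \<alpha>V C0 by (auto simp: b_def mult_left_le)
    have HS: "H (Suc i) = k q + \<phi> y" by (simp add: H_def q_def y_def)
    have sS: "s (Suc i) = (y - xstar) \<bullet> q" by (simp add: s_def q_def y_def)
    have Vb: "V' = k q + \<phi> y + b * s (Suc i)" using V'(3) by (simp add: b_def HS)
    have P: "k q \<le> P" using k_above[of q 0] k_min by (simp add: P_def v_def)

    \<comment> \<open>The tangent of \<open>k\<close> at \<open>q\<close> and that of
      \<open>f\<close> at \<open>y\<close> leave gradient terms that differ only in where the
      gradient of \<open>f\<close> is taken; \<open>hess\<close> makes this difference second order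
      in \<epsilon>.\<close>
    have dk: "k q - k (p i) \<le> - (\<gamma> * \<epsilon> * P) - \<epsilon> * (grad f (x i) \<bullet> v)"
    proof -
      have "k q + v \<bullet> (p i - q) \<le> k (p i)" unfolding v_def by (rule k_above)
      then show ?thesis by (simp add: qp P_def inner_commute algebra_simps)
    qed
    have df: "\<phi> y - \<phi> (x i) \<le> \<epsilon> * (grad f y \<bullet> v)"
      using f_above[of y "x i"] by (simp add: yx \<phi>_def)
    have hess: "\<epsilon> * (grad f y \<bullet> v) - \<epsilon> * (grad f (x i) \<bullet> v) \<le> 6 * \<epsilon>\<^sup>2 * D\<^sub>f\<^sub>k * (\<alpha> (2 * V') * V')"
    proof -
      \<comment> \<open>\<open>2 * V' \<le> 3 * H (Suc i)\<close> handles \<alpha>, and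
        \<open>H (Suc i) \<le> 2 * V'\<close> doubles the 3 of \<open>segment\<close> to the 6 in
        \<open>K\<close>.\<close>
      have aH: "\<alpha> (3 * H (Suc i)) * H (Suc i) \<le> \<alpha> (2 * V') * (2 * V')"
        using V' V0 \<alpha>V H_nonneg[of "Suc i"] \<alpha>_anti[of "2 * V'" "3 * H (Suc i)"]
        by (intro mult_mono) auto
      have "(grad f (x i + \<epsilon> *\<^sub>R v) - grad f (x i)) \<bullet> (\<epsilon> *\<^sub>R v)
          \<le> \<epsilon>\<^sup>2 * (3 * D\<^sub>f\<^sub>k * (\<alpha> (3 * H (Suc i)) * H (Suc i)))"
      proof (rule inner_grad_diff_le[OF f_diff_at f_C2])
        fix t :: real assume t: "0 \<le> t" "t \<le> 1" and ne: "x i + t *\<^sub>R \<epsilon> *\<^sub>R v \<noteq> xstar"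
        define z where "z = x i + t *\<^sub>R \<epsilon> *\<^sub>R v"
        have "v \<bullet> (hessian f z *v v) \<le> 3 * D\<^sub>f\<^sub>k * (\<alpha> (3 * H (Suc i)) * H (Suc i))"
          unfolding v_def
        proof (rule segment[OF HS])
          show "z = y - ((1 - t) * \<epsilon>) *\<^sub>R grad k q"
            by (simp add: z_def yx v_def algebra_simps)
        qed (use t ne eps(1) in \<open>auto simp: z_def mult_left_le_one_le\<close>)
        then have "\<epsilon>\<^sup>2 * (v \<bullet> (hessian f z *v v))
            \<le> \<epsilon>\<^sup>2 * (3 * D\<^sub>f\<^sub>k * (\<alpha> (3 * H (Suc i)) * H (Suc i)))"
          by (intro mult_left_mono) auto
        then show "\<epsilon> *\<^sub>R v \<bullet> (hessian f (x i + t *\<^sub>R \<epsilon> *\<^sub>R v) *v (\<epsilon> *\<^sub>R v))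
            \<le> \<epsilon>\<^sup>2 * (3 * D\<^sub>f\<^sub>k * (\<alpha> (3 * H (Suc i)) * H (Suc i)))"
          by (simp add: z_def matrix_vector_mult_scaleR power2_eq_square)
      next
        show "0 \<le> \<epsilon>\<^sup>2 * (3 * D\<^sub>f\<^sub>k * (\<alpha> (3 * H (Suc i)) * H (Suc i)))"
          using D_fk H_nonneg[of "Suc i"] \<alpha>_pos[of "3 * H (Suc i)"] by simp
      qed
      also have "\<dots> \<le> \<epsilon>\<^sup>2 * (3 * D\<^sub>f\<^sub>k * (\<alpha> (2 * V') * (2 * V')))"
        using aH D_fk by (intro mult_left_mono) auto
      finally show ?thesis by (simp add: yx algebra_simps)
    qed
    \<comment> \<open>The cross term supplies the dissipation in \<open>f\<close>: convexity at
      \<open>x i\<close> bounds the inner product below by \<phi>.\<close>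
    have ds: "s (Suc i) - s i \<le> \<epsilon> * (1 + \<gamma> * \<epsilon>) * P - \<gamma> * \<epsilon> * s (Suc i) - \<epsilon> * \<phi> (x i)"
    proof -
      have "s (Suc i) - s i
          = \<epsilon> * (1 + \<gamma> * \<epsilon>) * P - \<gamma> * \<epsilon> * s (Suc i) - \<epsilon> * (grad f (x i) \<bullet> (x i - xstar))"
        unfolding sS by (simp add: s_def qp yx P_def inner_commute algebra_simps)
      moreover have "\<epsilon> * \<phi> (x i) \<le> \<epsilon> * (grad f (x i) \<bullet> (x i - xstar))"
        using f_above[of "x i" xstar] eps by (intro mult_left_mono) (auto simp: \<phi>_def inner_diff_right)
      ultimately show ?thesis by linarith
    qed
    \<comment> \<open>Passing from the old position to the new one costs the
      \<open>C\<^sub>f\<^sub>k\<close> part of \<open>K\<close>.\<close>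
    have \<phi>x: "\<phi> y - \<epsilon> * (C\<^sub>f\<^sub>k * (2 * V')) \<le> \<phi> (x i)"
    proof -
      have "grad f y \<bullet> v \<le> C\<^sub>f\<^sub>k * H (Suc i)"
        using C_fk(2)[rule_format, of y q] by (simp add: Ham HS v_def)
      also have "\<dots> \<le> C\<^sub>f\<^sub>k * (2 * V')" using V' C_fk by (intro mult_left_mono) auto
      finally have "\<epsilon> * (grad f y \<bullet> v) \<le> \<epsilon> * (C\<^sub>f\<^sub>k * (2 * V'))"
        using eps by (intro mult_left_mono) auto
      with df show ?thesis by linarith
    qed
    have main: "(1 - \<gamma>) * b * V' \<le> (\<gamma> - b * (1 + \<gamma> * \<epsilon>)) * P + \<gamma> * b * s (Suc i) + b * \<phi> y"
    proof -
      have kV: "k q \<le> 2 * V'" using V'(1) \<phi>0[of y] by (simp add: HS)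
      have "C\<^sub>\<alpha> / 2 * (\<alpha> (2 * V') * \<bar>s (Suc i)\<bar>) \<le> C\<^sub>\<alpha> / 2 * (\<alpha> (2 * V') * \<phi> y + k q)"
        using young[OF kV, of y] C0 by (intro mult_left_mono) (auto simp: sS)
      then have "b * \<bar>s (Suc i)\<bar> \<le> b * \<phi> y + C\<^sub>\<alpha> / 2 * k q"
        by (simp add: b_def algebra_simps)
      then have "(1 - \<gamma>) * b * V'
          \<le> (\<gamma> - b * (1 + \<gamma> * \<epsilon>)) * k q + \<gamma> * b * s (Suc i) + b * \<phi> y"
        using dissipation_lower_bound[OF b C_alpha(2) gamma less_imp_le[OF eps(1)] eps2 k0 \<phi>0]
        by (simp add: Vb)
      \<comment> \<open>The coefficient of \<open>P\<close> is nonnegative, so \<open>k q\<close>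
        may be raised to \<open>P\<close>.\<close>
      moreover have "0 \<le> \<gamma> - b * (1 + \<gamma> * \<epsilon>)"
      proof -
        have "\<gamma> * \<epsilon> \<le> 1 * 1" using gamma eps eps2 by (intro mult_mono) auto
        then have "b * (1 + \<gamma> * \<epsilon>) \<le> C\<^sub>\<alpha> / 2 * 2" using b gamma eps by (intro mult_mono) auto
        then show ?thesis using C_alpha by simp
      qed
      ultimately show ?thesis using mult_left_mono[OF P, of "\<gamma> - b * (1 + \<gamma> * \<epsilon>)"] by simp
    qed
    have "V' - b * s i - H i = (H (Suc i) - H i) + b * (s (Suc i) - s i)"
      using Vb by (simp add: HS algebra_simps)
    also have "H (Suc i) - H i \<le> - (\<gamma> * \<epsilon> * P) + 6 * \<epsilon>\<^sup>2 * D\<^sub>f\<^sub>k * (\<alpha> (2 * V') * V')"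
      using dk df hess by (simp add: H_def HS q_def y_def)
    also have "b * (s (Suc i) - s i) \<le> b * (\<epsilon> * (1 + \<gamma> * \<epsilon>) * P - \<gamma> * \<epsilon> * s (Suc i)
        - \<epsilon> * (\<phi> y - \<epsilon> * (C\<^sub>f\<^sub>k * (2 * V'))))"
    proof (rule mult_left_mono[OF _ b(1)])
      show "s (Suc i) - s i \<le> \<epsilon> * (1 + \<gamma> * \<epsilon>) * P - \<gamma> * \<epsilon> * s (Suc i)
          - \<epsilon> * (\<phi> y - \<epsilon> * (C\<^sub>f\<^sub>k * (2 * V')))"
        using ds mult_left_mono[OF \<phi>x, of \<epsilon>] eps(1) by linarith
    qed
    also have "- (\<gamma> * \<epsilon> * P) + 6 * \<epsilon>\<^sup>2 * D\<^sub>f\<^sub>k * (\<alpha> (2 * V') * V')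
        + b * (\<epsilon> * (1 + \<gamma> * \<epsilon>) * P - \<gamma> * \<epsilon> * s (Suc i) - \<epsilon> * (\<phi> y - \<epsilon> * (C\<^sub>f\<^sub>k * (2 * V'))))
        = - \<epsilon> * ((\<gamma> - b * (1 + \<gamma> * \<epsilon>)) * P + \<gamma> * b * s (Suc i) + b * \<phi> y)
          + 2 * \<epsilon>\<^sup>2 * K * b * V'"
      using C_alpha by (simp add: K_def b_def field_simps power2_eq_square)
    also have "\<dots> \<le> - \<epsilon> * ((1 - \<gamma>) * b * V') + 2 * \<epsilon>\<^sup>2 * K * b * V'"
      using main eps(1) by simp
    also have "\<dots> = - (2 * (c * \<alpha> (2 * V')) * V')"
      by (simp add: c_def b_def field_simps power2_eq_square)
    finally show ?thesis by (simp add: b_def)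
  qed

  \<comment> \<open>Comparison with \<open>W\<close> and geometric decay\<close>
  have W_rec: "W (Suc i) = W i / (1 + c * \<alpha> (2 * W i))" for i
    using W_Suc unfolding c_def K_def divide_inverse by blast
  have W0: "W 0 = H 0" using W_0 p_0 k_min by (simp add: H_def \<phi>_def)
  have H0': "H0 = H 0" using H0 Ham by (simp add: H_def)

  have bound: "\<exists>V. H i \<le> 2 * V \<and> V = H i + C\<^sub>\<alpha> / 2 * \<alpha> (2 * V) * s i \<and> V \<le> W i" for i
  proof (induction i)
    case 0
    \<comment> \<open>Zero initial momentum gives \<open>s 0 = 0\<close>, so \<open>H 0\<close>
      solves its own equation.\<close>
    show ?case
      using H_nonneg[of 0] by (intro exI[of _ "H 0"]) (simp add: W0 s_def p_0)
  next
    case (Suc i)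
    then obtain V where V: "H i \<le> 2 * V" "V = H i + C\<^sub>\<alpha> / 2 * \<alpha> (2 * V) * s i" "V \<le> W i"
      by blast
    obtain V' where V': "H (Suc i) / 2 \<le> V'" "V' \<le> 3 / 2 * H (Suc i)"
      "V' = H (Suc i) + C\<^sub>\<alpha> / 2 * \<alpha> (2 * V') * s (Suc i)"
      using exists by blast
    have nonneg: "0 \<le> V" "0 \<le> V'" using V(1) V'(1) H_nonneg[of i] H_nonneg[of "Suc i"] by auto
    have rate: "0 < c * \<alpha> (2 * y)" "c * \<alpha> (2 * y) \<le> 1" if "0 \<le> y" for y
      using \<alpha>_pos[of "2 * y"] \<alpha>_le1[of "2 * y"] c0 c1 that
      by (auto intro: mult_le_one)
    have le: "V' * (1 + c * \<alpha> (2 * V')) \<le> V"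
      by (rule modified_energy_contracts[OF \<alpha>_slow \<alpha>_pos \<alpha>_anti young_H C0 nonneg(1) V(1,2)
            nonneg(2) step[OF V'] rate[OF nonneg(2)]])
    have VV': "V' \<le> V"
    proof -
      have "V' * 1 \<le> V' * (1 + c * \<alpha> (2 * V'))"
        using nonneg rate(1)[OF nonneg(2)] by (intro mult_left_mono) auto
      with le show ?thesis by simp
    qed
    \<comment> \<open>Since V' \<le> V \<le> W i and \<alpha> is nonincreasing, the rate at
      \<open>V'\<close> is at least the rate at \<open>W i\<close> used by the recursion.\<close>
    have "V' * (1 + c * \<alpha> (2 * W i)) \<le> W i"
    proof -
      define r where "r = c * \<alpha> (2 * V)"
      define r' where "r' = c * \<alpha> (2 * W i)"
      have "r \<le> c * \<alpha> (2 * V')" "r' \<le> r"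
        unfolding r_def r'_def using VV' V(3) nonneg c0
        by (auto intro!: mult_left_mono \<alpha>_anti)
      then have "V' * (1 + r') \<le> V' * (1 + c * \<alpha> (2 * V'))"
        using nonneg by (intro mult_left_mono) auto
      with le V(3) show ?thesis by (simp add: r'_def)
    qed
    moreover have "0 < 1 + c * \<alpha> (2 * W i)" using rate(1)[of "W i"] nonneg V(3) by simp
    ultimately have "V' \<le> W (Suc i)" by (simp add: W_rec pos_le_divide_eq)
    then show ?case using V' by (intro exI[of _ V']) auto
  qed
  have W_nonneg: "0 \<le> W i" for i
    using bound[of i] H_nonneg[of i] by auto
  have \<alpha>star: "0 < \<alpha>star" using \<alpha>_pos[of "3 * H0"] H_nonneg[of 0] by (simp add: alphastar H0')
  \<comment> \<open>Monotonicity is carried along because W i \<le> W 0 = H0 gives 2 W i \<le> 3 H0,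
    hence a rate of at least \<open>c * \<alpha>star\<close>.\<close>
  have decay: "W i \<le> W 0 \<and> W i * (1 + c * \<alpha>star) ^ i \<le> W 0" for i
  proof (induction i)
    case 0
    show ?case by simp
  next
    case (Suc i)
    have "\<alpha>star \<le> \<alpha> (2 * W i)"
      unfolding alphastar H0' using Suc W_nonneg[of i] W0 by (intro \<alpha>_anti) auto
    then have "c * \<alpha>star \<le> c * \<alpha> (2 * W i)" using c0 by simp
    moreover have "0 < c * \<alpha>star" using c0 \<alpha>star by simp
    ultimately have r: "1 + c * \<alpha>star \<le> 1 + c * \<alpha> (2 * W i)" "1 < 1 + c * \<alpha>star" by auto
    then have "W (Suc i) \<le> W i / (1 + c * \<alpha>star)"
      unfolding W_rec using W_nonneg by (intro divide_left_mono) auto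
    then have 1: "W (Suc i) * (1 + c * \<alpha>star) \<le> W i"
      using r by (simp add: pos_le_divide_eq)
    have "W (Suc i) * (1 + c * \<alpha>star) ^ Suc i = (W (Suc i) * (1 + c * \<alpha>star)) * (1 + c * \<alpha>star) ^ i"
      by simp
    also have "\<dots> \<le> W i * (1 + c * \<alpha>star) ^ i" using 1 r by (intro mult_right_mono) auto
    finally have 2: "W (Suc i) * (1 + c * \<alpha>star) ^ Suc i \<le> W 0" using Suc by simp
    have "W (Suc i) * 1 \<le> W (Suc i) * (1 + c * \<alpha>star)"
      using r W_nonneg by (intro mult_left_mono) auto
    with 1 2 Suc show ?case by simp
  qed
  show ?thesis
  proof (intro allI conjI)
    fix i
    obtain V where V: "H i \<le> 2 * V" "V \<le> W i" using bound by blast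
    have "f (x i) - f xstar \<le> H i" using k0[of "p i"] by (simp add: H_def \<phi>_def)
    with V show "f (x i) - f xstar \<le> 2 * W i" by linarith
    have "0 < (1 + c * \<alpha>star) ^ i" using c0 \<alpha>star by (simp add: add_pos_pos)
    then have "W i \<le> W 0 * (1 + c * \<alpha>star) powi (- int i)"
      using decay[of i] by (simp add: power_int_minus pos_le_divide_eq flip: divide_inverse)
    then show "2 * W i \<le> 2 * W 0 * (1 + \<epsilon> * C\<^sub>\<alpha> / 4 *
             (1 - \<gamma> - 2 * \<epsilon> * (C\<^sub>f\<^sub>k + 6 * D\<^sub>f\<^sub>k / C\<^sub>\<alpha>)) * \<alpha>star) powi (- int i)"
      by (simp add: c_def K_def)
  qed
qed

end
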